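(* Let $\alpha$ be an infinite word over an alphabet $\mathcal A\subseteq\mathbb N$, and let $\mathcal A^{\alpha}\subseteq\mathcal A$ be the set of letters that appear infinitely many times in $\alpha$. If $\mathcal A^{\alpha}$ is infinite, then the path-star graph class $\mathcal R^{\alpha}$ has unbounded tree-width and unbounded clique-width.
   Context: $\mathbb N=\{1,2,3,\dots\}$, and $\alpha_j$ denotes the $j$-th letter of the infinite word $\alpha$. The infinite path-star graph $R^{\alpha}=(V_P\cup V_S,\;E_P\cup E_S)$ has path-vertices $V_P=\{p_j: j\in\mathbb N\}$, star-vertices $V_S=\{s_i: i\in\mathbb N\}$, path edges $E_P=\{p_jp_{j+1}: j\in\mathbb N\}$ and star edges $E_S=\{p_js_{\alpha_j}: j\in\mathbb N\}$. The path-star class $\mathcal R^{\alpha}$ is the class of all finite induced subgraphs of $R^{\alpha}$ (up to isomorphism). A graph class has unbounded tree-width (clique-width) if there is no constant bounding the tree-width (clique-width) of all its members. The clique-width of a graph is the minimum number of labels needed to construct it using the operations: creating a new vertex with a label, disjoint union of labelled graphs, adding all edges between vertices labelled $i$ and vertices labelled $j$ ($i\neq j$), and relabelling all vertices with label $i$ to label $j$. *)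

theory Defs
  imports Main
begin

section \<open>Simple graphs\<close>

text \<open>Edges are two-element sets of vertices. Graphs may be infinite.\<close>

record 'v ugraph =
  verts :: "'v set"
  edges :: "'v set set"

definition simple_graph :: "'v ugraph \<Rightarrow> bool" where
  "simple_graph G \<longleftrightarrow> (\<forall>e \<in> edges G. \<exists>u v. e = {u, v} \<and> u \<in> verts G \<and> v \<in> verts G \<and> u \<noteq> v)"

definition induced_subgraph :: "'v ugraph \<Rightarrow> 'v set \<Rightarrow> 'v ugraph" where
  "induced_subgraph G U = \<lparr>verts = verts G \<inter> U, edges = {e \<in> edges G. e \<subseteq> U}\<rparr>"

definition isomorphic :: "'v ugraph \<Rightarrow> 'w ugraph \<Rightarrow> bool" where
  "isomorphic G H \<longleftrightarrow>
     (\<exists>f. bij_betw f (verts G) (verts H) \<and>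
          (\<forall>u \<in> verts G. \<forall>v \<in> verts G. {u, v} \<in> edges G \<longleftrightarrow> {f u, f v} \<in> edges H))"

definition connected_graph :: "'v ugraph \<Rightarrow> bool" where
  "connected_graph G \<longleftrightarrow>
     verts G \<noteq> {} \<and> (\<forall>u \<in> verts G. \<forall>v \<in> verts G. (u, v) \<in> {(x, y). {x, y} \<in> edges G}\<^sup>*)"

definition is_cycle :: "'v ugraph \<Rightarrow> 'v list \<Rightarrow> bool" where
  "is_cycle G vs \<longleftrightarrow>
     length vs \<ge> 3 \<and> distinct vs \<and>
     (\<forall>i < length vs. {vs ! i, vs ! (Suc i mod length vs)} \<in> edges G)"

definition finite_tree :: "'v ugraph \<Rightarrow> bool" where
  "finite_tree T \<longleftrightarrow>
     simple_graph T \<and> finite (verts T) \<and> connected_graph T \<and> (\<nexists>vs. is_cycle T vs)"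

section \<open>Tree-width\<close>

text \<open>The nodes of a decomposition tree are natural numbers; up to renaming of nodes every
  finite tree is of this form.\<close>

definition tree_decomposition :: "'v ugraph \<Rightarrow> nat ugraph \<Rightarrow> (nat \<Rightarrow> 'v set) \<Rightarrow> bool" where
  "tree_decomposition G T B \<longleftrightarrow>
     finite_tree T \<and>
     (\<Union>t \<in> verts T. B t) = verts G \<and>
     (\<forall>e \<in> edges G. \<exists>t \<in> verts T. e \<subseteq> B t) \<and>
     (\<forall>v \<in> verts G. connected_graph (induced_subgraph T {t \<in> verts T. v \<in> B t}))"

text \<open>Subtraction is truncated, so that the graph without vertices has tree-width 0;
  for all other graphs no truncation takes place.\<close>

definition decomposition_width :: "nat ugraph \<Rightarrow> (nat \<Rightarrow> 'v set) \<Rightarrow> nat" where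
  "decomposition_width T B = Max ((\<lambda>t. card (B t)) ` verts T) - 1"

definition tree_width :: "'v ugraph \<Rightarrow> nat" where
  "tree_width G = (LEAST w. \<exists>T B. tree_decomposition G T B \<and> decomposition_width T B = w)"

section \<open>Clique-width\<close>

text \<open>\<open>cw_construct k G lab\<close> states that \<open>G\<close>, with every vertex \<open>v\<close> labelled \<open>lab v\<close>, can be
  built by the clique-width operations using the labels \<open>0, \<dots>, k - 1\<close>. The values of \<open>lab\<close>
  outside \<open>verts G\<close> carry no meaning.\<close>

inductive cw_construct :: "nat \<Rightarrow> 'v ugraph \<Rightarrow> ('v \<Rightarrow> nat) \<Rightarrow> bool" for k :: nat where
  new_vertex:
    "i < k \<Longrightarrow> cw_construct k \<lparr>verts = {v}, edges = {}\<rparr> (\<lambda>_. i)"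
| disjoint_union:
    "cw_construct k G lab \<Longrightarrow> cw_construct k H lab' \<Longrightarrow> verts G \<inter> verts H = {} \<Longrightarrow>
     cw_construct k \<lparr>verts = verts G \<union> verts H, edges = edges G \<union> edges H\<rparr>
       (\<lambda>v. if v \<in> verts G then lab v else lab' v)"
| join:
    "cw_construct k G lab \<Longrightarrow> i < k \<Longrightarrow> j < k \<Longrightarrow> i \<noteq> j \<Longrightarrow>
     cw_construct k
       \<lparr>verts = verts G,
        edges = edges G \<union> {{u, v} | u v. u \<in> verts G \<and> v \<in> verts G \<and> lab u = i \<and> lab v = j}\<rparr>
       lab"
| relabel:
    "cw_construct k G lab \<Longrightarrow> i < k \<Longrightarrow> j < k \<Longrightarrow>
     cw_construct k G (\<lambda>v. if lab v = i then j else lab v)"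

text \<open>The graph without vertices is not produced by the operations; it gets clique-width 0.\<close>

definition clique_width :: "'v ugraph \<Rightarrow> nat" where
  "clique_width G = (if verts G = {} then 0 else (LEAST k. \<exists>lab. cw_construct k G lab))"

section \<open>Graph classes of unbounded width\<close>

definition unbounded_tree_width :: "'v ugraph set \<Rightarrow> bool" where
  "unbounded_tree_width \<C> \<longleftrightarrow> (\<nexists>c. \<forall>G \<in> \<C>. tree_width G \<le> c)"

definition unbounded_clique_width :: "'v ugraph set \<Rightarrow> bool" where
  "unbounded_clique_width \<C> \<longleftrightarrow> (\<nexists>c. \<forall>G \<in> \<C>. clique_width G \<le> c)"

section \<open>Infinite words and path-star graphs\<close>

text \<open>Here the natural numbers start at 1: letters are positive, and the letters of a word
  \<open>\<alpha>\<close> are \<open>\<alpha> 1, \<alpha> 2, \<dots>\<close>; the value \<open>\<alpha> 0\<close> is not part of the word.\<close>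

definition infinite_word :: "nat set \<Rightarrow> (nat \<Rightarrow> nat) \<Rightarrow> bool" where
  "infinite_word A \<alpha> \<longleftrightarrow> A \<subseteq> {1..} \<and> (\<forall>j \<ge> 1. \<alpha> j \<in> A)"

definition recurring_letters :: "nat set \<Rightarrow> (nat \<Rightarrow> nat) \<Rightarrow> nat set" where
  "recurring_letters A \<alpha> = {a \<in> A. infinite {j. j \<ge> 1 \<and> \<alpha> j = a}}"

datatype ps_vertex = PathV nat | StarV nat

definition path_star_graph :: "(nat \<Rightarrow> nat) \<Rightarrow> ps_vertex ugraph" where
  "path_star_graph \<alpha> =
     \<lparr>verts = {PathV j | j. j \<ge> 1} \<union> {StarV i | i. i \<ge> 1},
      edges = {{PathV j, PathV (j + 1)} | j. j \<ge> 1} \<union> {{PathV j, StarV (\<alpha> j)} | j. j \<ge> 1}\<rparr>"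

text \<open>Membership is up to isomorphism. Since \<^typ>\<open>ps_vertex\<close> is infinite, every finite graph
  has an isomorphic copy on this vertex type.\<close>

definition path_star_class :: "(nat \<Rightarrow> nat) \<Rightarrow> ps_vertex ugraph set" where
  "path_star_class \<alpha> =
     {G. simple_graph G \<and>
         (\<exists>U \<subseteq> verts (path_star_graph \<alpha>).
            finite U \<and> isomorphic G (induced_subgraph (path_star_graph \<alpha>) U))}"

end

theory Submission imports Defs begin

text \<open>Let \<open>S\<close> be a finite set of letters that recur infinitely often. The path can be cut into
  consecutive finite blocks such that every letter of \<open>S\<close> occurs in every block
  (\<open>block_boundaries_exist\<close>). Keep only the stars in \<open>S\<close> and an initial piece of the path that
  consists of whole blocks: every block is then adjacent to every star, much as in a complete
  bipartite graph. Both widths of these finite graphs grow with \<open>S\<close>.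

  \<^emph>\<open>Tree-width.\<close> Pair the \<open>n\<close> stars of \<open>S\<close> with \<open>n\<close> blocks. A star together with its
  block is a connected set, the \<open>n\<close> sets are disjoint, and any two of them are joined by an edge:
  this is a complete minor on \<open>n\<close> vertices. In a tree decomposition the bags that meet a connected
  set form a subtree, and these subtrees meet pairwise, so by the Helly property of subtrees
  some bag meets all \<open>n\<close> sets (\<open>complete_minor_le_tree_width\<close>).

  \<^emph>\<open>Clique-width.\<close> At every moment of a construction with \<open>k\<close> labels, the part \<open>X\<close> built so
  far has at most \<open>k\<close> classes of vertices with the same neighbours outside \<open>X\<close>. A suitable moment
  splits the stars evenly, with more than \<open>k\<close> of them on each side
  (\<open>balanced_cut_with_few_types\<close>). A block outside \<open>X\<close> would tell all stars of \<open>X\<close> apart,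
  and a block inside \<open>X\<close> would have vertices that are told apart by the stars outside, and in both
  cases \<open>X\<close> would have more than \<open>k\<close> classes. Hence the path crosses the boundary of \<open>X\<close> within
  every block. The inner ends of crossing edges in different blocks have different
  neighbours outside \<open>X\<close>, so \<open>k + 1\<close> blocks again give too many classes
  (\<open>segment_clique_width_gt\<close>).\<close>

section \<open>Connected vertex sets\<close>

definition steps_within :: "'v ugraph \<Rightarrow> 'v set \<Rightarrow> ('v \<times> 'v) set" where
  "steps_within G S = {(x, y). {x, y} \<in> edges G \<and> x \<in> S \<and> y \<in> S}"

lemma connected_induced_iff:
  assumes "S \<subseteq> verts G"
  shows "connected_graph (induced_subgraph G S) \<longleftrightarrow>
    S \<noteq> {} \<and> (\<forall>u\<in>S. \<forall>v\<in>S. (u, v) \<in> (steps_within G S)\<^sup>*)"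
proof -
  have "verts G \<inter> S = S" using assms by blast
  moreover have "{(x, y). {x, y} \<in> {e \<in> edges G. e \<subseteq> S}} = steps_within G S"
    unfolding steps_within_def by auto
  ultimately show ?thesis unfolding connected_graph_def induced_subgraph_def by simp
qed

lemma connected_iff:
  assumes "simple_graph G"
  shows "connected_graph G \<longleftrightarrow> connected_graph (induced_subgraph G (verts G))"
proof -
  have "\<forall>e\<in>edges G. e \<subseteq> verts G"
    using assms unfolding simple_graph_def by (metis empty_subsetI insert_subset)
  then have "edges (induced_subgraph G (verts G)) = edges G"
    unfolding induced_subgraph_def by auto
  then show ?thesis
    unfolding connected_graph_def by (simp add: induced_subgraph_def)
qed

lemma induced_induced:
  assumes "S \<subseteq> A"
  shows "induced_subgraph (induced_subgraph G A) S = induced_subgraph G S"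
  using assms unfolding induced_subgraph_def by auto

lemma steps_within_mono: "S \<subseteq> S' \<Longrightarrow> steps_within G S \<subseteq> steps_within G S'"
  unfolding steps_within_def by auto

lemma simple_induced: "simple_graph G \<Longrightarrow> simple_graph (induced_subgraph G S)"
  unfolding simple_graph_def induced_subgraph_def by fastforce

section \<open>Leaves and the Helly property of subtrees\<close>

text \<open>The first vertex of a longest path is a leaf: all its neighbours lie on the path, and a
  neighbour other than the second vertex would close a cycle.\<close>

lemma finite_tree_has_leaf:
  assumes T: "finite_tree T" and "t \<in> verts T" and "verts T \<noteq> {t}"
  obtains l m where "l \<in> verts T" "m \<in> verts T" "l \<noteq> m" "{l, m} \<in> edges T"
    "\<And>x. {l, x} \<in> edges T \<Longrightarrow> x = m"
proof -
  have simp: "\<And>x y. {x, y} \<in> edges T \<Longrightarrow> x \<in> verts T \<and> y \<in> verts T \<and> x \<noteq> y"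
    using T unfolding finite_tree_def simple_graph_def
    by (metis doubleton_eq_iff)
  have fin: "finite (verts T)" and acyc: "\<nexists>vs. is_cycle T vs"
    using T by (auto simp: finite_tree_def)
  obtain t' where t': "t' \<in> verts T" "t' \<noteq> t" using assms(2,3) by blast
  then have "(t, t') \<in> {(x, y). {x, y} \<in> edges T}\<^sup>*"
    using T assms(2) unfolding finite_tree_def connected_graph_def by blast
  then obtain s where s: "{t, s} \<in> edges T"
    using t'(2) by (cases rule: converse_rtranclE) auto
  define P where "P xs \<longleftrightarrow> distinct xs \<and> set xs \<subseteq> verts T \<and>
    successively (\<lambda>x y. {x, y} \<in> edges T) xs" for xs
  have "P [t, s]" using s simp[OF s] by (simp add: P_def)
  moreover have "\<forall>xs. P xs \<longrightarrow> length xs \<le> card (verts T)"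
    unfolding P_def using fin by (metis card_mono distinct_card)
  ultimately obtain xs where xs: "P xs" and max: "\<And>ys. P ys \<Longrightarrow> length ys \<le> length xs"
    using ex_has_greatest_nat[of P "[t, s]" length "Suc (card (verts T))"]
    by (auto simp: less_Suc_eq_le)
  have "length xs \<ge> 2" using max[OF \<open>P [t, s]\<close>] by simp
  then obtain l m ys where xs_eq: "xs = l # m # ys"
    by (metis Suc_le_length_iff numeral_2_eq_2)
  have lm: "{l, m} \<in> edges T" using xs by (simp add: P_def xs_eq)
  have "x = m" if x: "{l, x} \<in> edges T" for x
  proof -
    \<comment> \<open>By maximality the path cannot be prolonged by \<open>x\<close>, so \<open>x\<close> already lies on it.\<close>
    have "x \<in> set xs"
    proof (rule ccontr)
      assume "x \<notin> set xs"
      then have "P (x # xs)"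
        using xs x simp[OF x] by (auto simp: P_def xs_eq insert_commute)
      then show False using max by fastforce
    qed
    then obtain i where i: "i < length xs" "xs ! i = x" by (auto simp: in_set_conv_nth)
    have "i \<noteq> 0" using i(2) simp[OF x] by (metis nth_Cons_0 xs_eq)
    moreover have "\<not> i \<ge> 2"
    proof
      assume "i \<ge> 2"
      let ?c = "take (Suc i) xs"
      have suc: "\<And>j. Suc j < length xs \<Longrightarrow> {xs ! j, xs ! Suc j} \<in> edges T"
        using xs unfolding P_def by (simp add: successively_conv_nth)
      have len: "length ?c = Suc i" using i by simp
      have "{?c ! j, ?c ! (Suc j mod length ?c)} \<in> edges T" if "j < length ?c" for j
      proof (cases "j = i")
        case True
        then have "?c ! j = x" using i(2) by simp
        moreover have "?c ! (Suc j mod length ?c) = l" using True len by (simp add: xs_eq)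
        ultimately have "?c ! j = x" "?c ! (Suc j mod length ?c) = l" by blast+
        then show ?thesis using x by (simp add: insert_commute)
      next
        case False
        then have "j < i" using that len by simp
        then show ?thesis using suc[of j] i len by simp
      qed
      moreover have "distinct ?c" using xs by (simp add: P_def)
      moreover have "length ?c \<ge> 3" using len \<open>i \<ge> 2\<close> by simp
      ultimately have "is_cycle T ?c" unfolding is_cycle_def by blast
      then show False using acyc by blast
    qed
    ultimately have "i = 1" by simp
    then show "x = m" using i by (simp add: xs_eq)
  qed
  then show thesis using that lm simp[OF lm] by blast
qed

text \<open>A walk can enter and leave the leaf \<open>l\<close> only through its neighbour \<open>m\<close>, so each detour to
  \<open>l\<close> may be cut out. In the induction over the walk, \<open>m\<close> stands in for \<open>l\<close> whenever the walk
  is currently at \<open>l\<close>.\<close>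

lemma steps_avoid_leaf:
  assumes leaf: "\<And>x. {l, x} \<in> edges T \<Longrightarrow> x = m" and "l \<noteq> m"
    and uv: "(u, v) \<in> (steps_within T S)\<^sup>*" and "u \<noteq> l" "v \<noteq> l"
  shows "(u, v) \<in> (steps_within T (S - {l}))\<^sup>*"
proof -
  have "(u, if v = l then m else v) \<in> (steps_within T (S - {l}))\<^sup>*"
    using uv
  proof (induction rule: rtrancl_induct)
    case base
    then show ?case using \<open>u \<noteq> l\<close> by simp
  next
    case (step y z)
    have yz: "{y, z} \<in> edges T" "y \<in> S" "z \<in> S" using step(2) by (auto simp: steps_within_def)
    have "z = m" if "y = l" using leaf yz(1) that by blast
    moreover have "y = m" if "z = l" using leaf[of y] yz(1) that by (simp add: insert_commute)
    ultimately consider "y = l" "z = m" | "z = l" "y = m" | "y \<noteq> l" "z \<noteq> l" by blast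
    then show ?case
    proof cases
      case 3
      then have "(y, z) \<in> steps_within T (S - {l})" using yz by (simp add: steps_within_def)
      then show ?thesis using step.IH 3 by simp
    qed (use step.IH \<open>l \<noteq> m\<close> in simp_all)
  qed
  then show ?thesis using \<open>v \<noteq> l\<close> by simp
qed

lemma connected_remove_leaf:
  assumes leaf: "\<And>x. {l, x} \<in> edges T \<Longrightarrow> x = m" and "l \<noteq> m" and "S \<subseteq> verts T"
    and "connected_graph (induced_subgraph T S)" and "S \<noteq> {l}"
  shows "connected_graph (induced_subgraph T (S - {l}))"
proof -
  have "S - {l} \<subseteq> verts T" "S - {l} \<noteq> {}"
    using assms(3-5) by (auto simp: connected_induced_iff)
  moreover have "(u, v) \<in> (steps_within T (S - {l}))\<^sup>*" if "u \<in> S - {l}" "v \<in> S - {l}" for u v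
    using that assms(4) unfolding connected_induced_iff[OF assms(3)]
    by (intro steps_avoid_leaf[OF leaf \<open>l \<noteq> m\<close>]) auto
  ultimately show ?thesis by (simp add: connected_induced_iff)
qed

lemma leaf_neighbour_in_connected_set:
  assumes leaf: "\<And>x. {l, x} \<in> edges T \<Longrightarrow> x = m" and "S \<subseteq> verts T"
    and "connected_graph (induced_subgraph T S)" and "S \<noteq> {l}" and "l \<in> S"
  shows "m \<in> S"
proof -
  obtain v where "v \<in> S" "v \<noteq> l" using assms(4,5) by blast
  then have "(l, v) \<in> (steps_within T S)\<^sup>*" using assms by (simp add: connected_induced_iff)
  then obtain z where "(l, z) \<in> steps_within T S"
    using \<open>v \<noteq> l\<close> by (cases rule: converse_rtranclE) auto
  then show ?thesis using leaf by (auto simp: steps_within_def)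
qed

lemma finite_tree_remove_leaf:
  assumes T: "finite_tree T" and leaf: "\<And>x. {l, x} \<in> edges T \<Longrightarrow> x = m"
    and "l \<noteq> m" "m \<in> verts T"
  shows "finite_tree (induced_subgraph T (verts T - {l}))"
proof -
  let ?T = "induced_subgraph T (verts T - {l})"
  have "simple_graph T" and "connected_graph T" using T by (auto simp: finite_tree_def)
  then have "connected_graph ?T"
    using connected_remove_leaf[OF leaf \<open>l \<noteq> m\<close>, where S = "verts T"] assms(3,4)
    by (metis connected_iff order_refl singletonD)
  moreover have "is_cycle T vs" if "is_cycle ?T vs" for vs
    using that unfolding is_cycle_def induced_subgraph_def by auto
  ultimately show ?thesis
    using T simple_induced unfolding finite_tree_def by (auto simp: induced_subgraph_def)
qed

text \<open>Induction by removing a leaf. A member of the family that consists of the leaf alone forces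
  the leaf into all members. Otherwise each member containing the leaf also contains its neighbour,
  so removing the leaf from the tree and from all members keeps the members connected and
  pairwise intersecting.\<close>

lemma subtrees_Helly:
  assumes "finite_tree T"
    and "\<And>S. S \<in> F \<Longrightarrow> S \<subseteq> verts T \<and> connected_graph (induced_subgraph T S)"
    and "\<And>S S'. S \<in> F \<Longrightarrow> S' \<in> F \<Longrightarrow> S \<inter> S' \<noteq> {}"
  shows "\<exists>t\<in>verts T. \<forall>S\<in>F. t \<in> S"
  using assms
proof (induction "card (verts T)" arbitrary: T F rule: less_induct)
  case less
  note T = less.prems(1) and conn = less.prems(2) and meet = less.prems(3)
  obtain t where t: "t \<in> verts T" using T by (auto simp: finite_tree_def connected_graph_def)
  show ?case
  proof (cases "verts T = {t}")
    case True
    then show ?thesis using conn meet by fastforce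
  next
    case False
    then obtain l m where lm: "l \<in> verts T" "m \<in> verts T" "l \<noteq> m"
      and leaf: "\<And>x. {l, x} \<in> edges T \<Longrightarrow> x = m"
      using finite_tree_has_leaf[OF T t] by metis
    show ?thesis
    proof (cases "{l} \<in> F")
      case True
      then show ?thesis using meet lm by blast
    next
      case no_single: False
      let ?T = "induced_subgraph T (verts T - {l})"
      let ?F = "(\<lambda>S. S - {l}) ` F"
      have verts: "verts ?T = verts T - {l}" by (auto simp: induced_subgraph_def)
      have "card (verts ?T) < card (verts T)"
        unfolding verts using T lm(1) by (meson card_Diff1_less finite_tree_def)
      moreover have "finite_tree ?T" using finite_tree_remove_leaf[OF T leaf] lm by blast
      moreover have "S \<subseteq> verts ?T \<and> connected_graph (induced_subgraph ?T S)" if S: "S \<in> ?F" for S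
      proof -
        obtain S0 where S0: "S0 \<in> F" "S = S0 - {l}" using S by blast
        have S0': "S0 \<subseteq> verts T" "connected_graph (induced_subgraph T S0)" "S0 \<noteq> {l}"
          using conn[OF S0(1)] S0(1) no_single by auto
        have "connected_graph (induced_subgraph T S)"
          unfolding S0(2) by (rule connected_remove_leaf[OF leaf lm(3) S0'])
        moreover have "S \<subseteq> verts T - {l}" using conn[OF S0(1)] S0(2) by blast
        ultimately show ?thesis by (simp add: verts induced_induced)
      qed
      moreover have "S \<inter> S' \<noteq> {}" if SS: "S \<in> ?F" "S' \<in> ?F" for S S'
      proof -
        obtain S0 S0' where S0: "S0 \<in> F" "S = S0 - {l}" "S0' \<in> F" "S' = S0' - {l}"
          using SS by blast
        \<comment> \<open>If the two sets meet only in the leaf, they also meet in its neighbour.\<close>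
        have "m \<in> R" if R: "R \<in> F" "l \<in> R" for R
        proof -
          have R': "R \<subseteq> verts T" "connected_graph (induced_subgraph T R)" "R \<noteq> {l}"
            using conn[OF R(1)] R(1) no_single by auto
          show ?thesis by (rule leaf_neighbour_in_connected_set[OF leaf R' R(2)])
        qed
        then show ?thesis using meet[OF S0(1,3)] S0 lm(3) by blast
      qed
      ultimately have "\<exists>t\<in>verts ?T. \<forall>S\<in>?F. t \<in> S" by (rule less.hyps)
      then obtain t where "t \<in> verts ?T" "\<forall>S\<in>?F. t \<in> S" by blast
      then have "t \<in> verts T" "\<forall>S\<in>F. t \<in> S" by (auto simp: verts)
      then show ?thesis by (rule bexI[rotated])
    qed
  qed
qed

section \<open>Complete minors bound tree-width from below\<close>

text \<open>For a single vertex this is part of the definition of a tree decomposition. The subtrees of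
  two adjacent vertices share the node whose bag contains their edge, so the subtrees of the
  vertices along a walk in \<open>M\<close> chain together.\<close>

lemma bags_meeting_connected_set:
  assumes td: "tree_decomposition G T B" and M: "M \<subseteq> verts G"
    and conn: "connected_graph (induced_subgraph G M)"
  shows "connected_graph (induced_subgraph T {t \<in> verts T. B t \<inter> M \<noteq> {}})"
proof -
  let ?S = "{t \<in> verts T. B t \<inter> M \<noteq> {}}"
  have cover: "(\<Union>t\<in>verts T. B t) = verts G"
    and edge: "\<And>e. e \<in> edges G \<Longrightarrow> \<exists>t\<in>verts T. e \<subseteq> B t"
    and bags: "\<And>v. v \<in> verts G \<Longrightarrow> connected_graph (induced_subgraph T {t \<in> verts T. v \<in> B t})"
    using td by (auto simp: tree_decomposition_def)
  have within: "(s, t) \<in> (steps_within T ?S)\<^sup>*"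
    if "v \<in> M" "s \<in> verts T" "t \<in> verts T" "v \<in> B s" "v \<in> B t" for v s t
  proof -
    have "{t \<in> verts T. v \<in> B t} \<subseteq> verts T" by blast
    from connected_induced_iff[OF this] have "(s, t) \<in> (steps_within T {t \<in> verts T. v \<in> B t})\<^sup>*"
      using bags[of v] that M by blast
    moreover have "{t \<in> verts T. v \<in> B t} \<subseteq> ?S" using that(1) by blast
    ultimately show ?thesis using rtrancl_mono[OF steps_within_mono] by blast
  qed
  have reach: "(s, t) \<in> (steps_within T ?S)\<^sup>*"
    if vw: "(v, w) \<in> (steps_within G M)\<^sup>*" and "v \<in> M" "s \<in> verts T" "v \<in> B s"
      and "t \<in> verts T" "w \<in> B t" for v w s t
    using vw that(5,6)
  proof (induction arbitrary: t rule: rtrancl_induct)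
    case base
    then show ?case using within that by blast
  next
    case (step y z)
    have yz: "{y, z} \<in> edges G" "z \<in> M" using step.hyps by (auto simp: steps_within_def)
    then obtain r where r: "r \<in> verts T" "y \<in> B r" "z \<in> B r" using edge by blast
    have "(r, t) \<in> (steps_within T ?S)\<^sup>*" using within[OF yz(2)] r step.prems by blast
    then show ?case using step.IH[OF r(1,2)] by simp
  qed
  obtain v where "v \<in> M" using conn M by (auto simp: connected_induced_iff)
  then have "?S \<noteq> {}" using cover M by blast
  moreover have "(s, t) \<in> (steps_within T ?S)\<^sup>*" if st: "s \<in> ?S" "t \<in> ?S" for s t
  proof -
    obtain v w where "v \<in> M" "v \<in> B s" "w \<in> M" "w \<in> B t" using st by blast
    moreover from this have "(v, w) \<in> (steps_within G M)\<^sup>*"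
      using conn unfolding connected_induced_iff[OF M] by blast
    ultimately show ?thesis using reach st by blast
  qed
  ultimately show ?thesis by (subst connected_induced_iff) auto
qed

text \<open>Some tree decomposition has to exist for the minimum in \<^const>\<open>tree_width\<close> to be
  attained.\<close>

lemma trivial_tree_decomposition:
  assumes "simple_graph G"
  shows "tree_decomposition G \<lparr>verts = {0}, edges = {}\<rparr> (\<lambda>_. verts G)"
proof -
  have "\<forall>e\<in>edges G. e \<subseteq> verts G"
    using assms unfolding simple_graph_def by (metis empty_subsetI insert_subset)
  moreover have "\<not> is_cycle \<lparr>verts = {0}, edges = {}\<rparr> vs" for vs :: "nat list"
    unfolding is_cycle_def by (cases vs) auto
  ultimately show ?thesis
    by (auto simp: tree_decomposition_def finite_tree_def simple_graph_def connected_graph_def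
        induced_subgraph_def)
qed

text \<open>By the Helly property a single bag meets all \<open>n\<close> branch sets \<open>M i\<close>; since these are disjoint,
  the bag has at least \<open>n\<close> vertices.\<close>

lemma complete_minor_le_tree_width:
  assumes G: "simple_graph G" "finite (verts G)"
    and M: "\<And>i. i < n \<Longrightarrow> M i \<subseteq> verts G \<and> connected_graph (induced_subgraph G (M i))"
    and disj: "\<And>i j. i < n \<Longrightarrow> j < n \<Longrightarrow> i \<noteq> j \<Longrightarrow> M i \<inter> M j = {}"
    and touch: "\<And>i j. i < n \<Longrightarrow> j < n \<Longrightarrow> i \<noteq> j \<Longrightarrow> \<exists>x\<in>M i. \<exists>y\<in>M j. {x, y} \<in> edges G"
  shows "n \<le> tree_width G + 1"
proof -
  let ?Q = "\<lambda>w. \<exists>T B. tree_decomposition G T B \<and> decomposition_width T B = w"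
  have "?Q (tree_width G)"
    unfolding tree_width_def by (rule LeastI_ex) (use trivial_tree_decomposition[OF G(1)] in blast)
  then obtain T B where td: "tree_decomposition G T B"
    and w: "decomposition_width T B = tree_width G" by blast
  let ?S = "\<lambda>i. {t \<in> verts T. B t \<inter> M i \<noteq> {}}"
  have T: "finite_tree T" and cover: "(\<Union>t\<in>verts T. B t) = verts G"
    and edge: "\<And>e. e \<in> edges G \<Longrightarrow> \<exists>t\<in>verts T. e \<subseteq> B t"
    using td by (auto simp: tree_decomposition_def)
  have conn: "connected_graph (induced_subgraph T (?S i))" if "i < n" for i
    using bags_meeting_connected_set[OF td] M[OF that] by blast
  have meet: "?S i \<inter> ?S j \<noteq> {}" if ij: "i < n" "j < n" for i j
  proof (cases "i = j")
    case True
    then show ?thesis using conn[OF ij(1)] by (auto simp: connected_graph_def induced_subgraph_def)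
  next
    case False
    then obtain x y where xy: "x \<in> M i" "y \<in> M j" "{x, y} \<in> edges G" using touch ij by blast
    then obtain t where "t \<in> verts T" "{x, y} \<subseteq> B t" using edge by metis
    then have "t \<in> ?S i \<inter> ?S j" using xy(1,2) by auto
    then show ?thesis by blast
  qed
  have "\<exists>t\<in>verts T. \<forall>S\<in>?S ` {..<n}. t \<in> S"
    using conn meet by (intro subtrees_Helly[OF T]) auto
  then obtain t where t: "t \<in> verts T" "\<And>i. i < n \<Longrightarrow> B t \<inter> M i \<noteq> {}" by auto
  then have "\<forall>i\<in>{..<n}. \<exists>v. v \<in> B t \<inter> M i" by blast
  then obtain f where f: "\<And>i. i < n \<Longrightarrow> f i \<in> B t \<inter> M i" by (meson bchoice lessThan_iff)
  have "inj_on f {..<n}"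
  proof (rule inj_onI)
    fix i j assume ij: "i \<in> {..<n}" "j \<in> {..<n}" "f i = f j"
    then have "f i \<in> M i \<inter> M j" using f[of i] f[of j] by simp
    then show "i = j" using disj[of i j] ij(1,2) by auto
  qed
  moreover have "finite (B t)" using cover t(1) G(2) by (metis UN_upper finite_subset)
  ultimately have "n \<le> card (B t)"
    using card_inj_on_le[of f "{..<n}" "B t"] f by (simp add: image_subset_iff)
  also have "\<dots> \<le> Max ((\<lambda>t. card (B t)) ` verts T)"
    using T t(1) by (auto simp: finite_tree_def)
  finally show ?thesis using w by (simp add: decomposition_width_def)
qed

section \<open>Clique-width expressions\<close>

lemma cw_construct_wellformed:
  assumes "cw_construct k G lab"
  shows "finite (verts G) \<and> (\<forall>v\<in>verts G. lab v < k) \<and> (\<forall>e\<in>edges G. e \<subseteq> verts G)"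
  using assms by induction auto

lemma cw_construct_edgeless:
  assumes "finite V" "V \<noteq> {}" "\<And>v. v \<in> V \<Longrightarrow> g v < k"
  shows "\<exists>lab. cw_construct k \<lparr>verts = V, edges = {}\<rparr> lab \<and> (\<forall>v\<in>V. lab v = g v)"
  using assms
proof (induction rule: finite_ne_induct)
  case (singleton x)
  then show ?case using cw_construct.new_vertex[of "g x" k x] by auto
next
  case (insert x F)
  then obtain lab where lab: "cw_construct k \<lparr>verts = F, edges = {}\<rparr> lab" "\<forall>v\<in>F. lab v = g v"
    by auto
  show ?case
    using cw_construct.disjoint_union[OF cw_construct.new_vertex[of "g x" k x] lab(1)] insert lab(2)
    by (intro exI[of _ "\<lambda>v. if v = x then g x else lab v"]) (auto simp: insert_is_Un[symmetric])
qed

text \<open>With a label of its own for each vertex, a join adds exactly one edge. This shows that the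
  minimum in \<^const>\<open>clique_width\<close> is attained.\<close>

lemma cw_construct_exists:
  assumes G: "simple_graph G" "finite (verts G)" "verts G \<noteq> {}"
  shows "\<exists>k lab. cw_construct k G lab"
proof -
  obtain g :: "'a \<Rightarrow> nat" and k where g: "g ` verts G = {i. i < k}" "inj_on g (verts G)"
    using finite_imp_inj_to_nat_seg[OF G(2)] by metis
  then obtain lab where base: "cw_construct k \<lparr>verts = verts G, edges = {}\<rparr> lab"
    and lab: "\<forall>v\<in>verts G. lab v = g v"
    using cw_construct_edgeless[OF G(2,3), of g k] by blast
  have "edges G \<subseteq> Pow (verts G)"
    using G(1) unfolding simple_graph_def by fastforce
  then have "finite (edges G)" using G(2) finite_subset by blast
  then have "cw_construct k \<lparr>verts = verts G, edges = edges G\<rparr> lab"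
    using subset_refl
  proof (induction rule: finite_subset_induct')
    case empty
    then show ?case using base by simp
  next
    case (insert e F)
    then obtain u v where e: "e = {u, v}" "u \<in> verts G" "v \<in> verts G" "u \<noteq> v"
      using G(1) unfolding simple_graph_def by blast
    have "{{x, y} |x y. x \<in> verts G \<and> y \<in> verts G \<and> lab x = g u \<and> lab y = g v} = {e}"
      using e lab g(2) by (auto simp: inj_on_def)
    moreover have "g u < k" "g v < k" "g u \<noteq> g v" using e g by (auto simp: inj_on_def)
    ultimately show ?case
      using cw_construct.join[OF insert.IH, of "g u" "g v"] by simp
  qed
  moreover have "\<lparr>verts = verts G, edges = edges G\<rparr> = G" by simp
  ultimately show ?thesis by metis
qed

lemma cw_construct_le_clique_width:
  assumes "simple_graph G" "finite (verts G)" "verts G \<noteq> {}"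
  shows "\<exists>lab. cw_construct (clique_width G) G lab"
  unfolding clique_width_def using assms LeastI_ex[OF cw_construct_exists[OF assms]] by simp

text \<open>The set \<open>X\<close> is the vertex set of a smallest stage of the construction that contains at
  least \<open>q\<close> vertices of \<open>W\<close>. Such a stage is a single vertex or a union of two stages
  with fewer than \<open>q\<close> of them each, whence the upper bound \<open>2 * q\<close>. The function \<open>f\<close> is
  the labelling at that stage. Vertices of \<open>X\<close> with the same label are never separated by
  later operations; they keep a common label, and this part of the conclusion carries the
  induction through later joins.\<close>

lemma balanced_cut_with_few_types:
  assumes "cw_construct k G lab" and "q \<ge> 1" and "q \<le> card (W \<inter> verts G)"
  shows "\<exists>X f. X \<subseteq> verts G \<and> q \<le> card (W \<inter> X) \<and> card (W \<inter> X) \<le> 2 * q \<and>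
     (\<forall>x\<in>X. f x < k) \<and>
     (\<forall>x\<in>X. \<forall>x'\<in>X. f x = f x' \<longrightarrow>
        lab x = lab x' \<and> (\<forall>y\<in>verts G - X. {x, y} \<in> edges G \<longleftrightarrow> {x', y} \<in> edges G))"
  using assms(1,3)
proof (induction)
  case (new_vertex i v)
  have "card (W \<inter> {v}) \<le> 1" using card_mono[of "{v}" "W \<inter> {v}"] by simp
  then show ?case using new_vertex \<open>q \<ge> 1\<close>
    by (intro exI[of _ "{v}"] exI[of _ "\<lambda>_. i"]) auto
next
  case (disjoint_union G lab H lab')
  note G = cw_construct_wellformed[OF disjoint_union.hyps(1)]
  note H = cw_construct_wellformed[OF disjoint_union.hyps(2)]
  have disj: "z \<notin> verts H" if "z \<in> verts G" for z using that disjoint_union.hyps(3) by blast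
  have edgeG: "x \<in> verts G \<and> y \<in> verts G" if "{x, y} \<in> edges G" for x y using G that by blast
  have edgeH: "x \<in> verts H \<and> y \<in> verts H" if "{x, y} \<in> edges H" for x y using H that by blast
  consider "q \<le> card (W \<inter> verts G)" | "q \<le> card (W \<inter> verts H)"
    | "card (W \<inter> verts G) < q" "card (W \<inter> verts H) < q" by linarith
  then show ?case
  proof cases
    case 1
    then obtain X f where X: "X \<subseteq> verts G" "q \<le> card (W \<inter> X)" "card (W \<inter> X) \<le> 2 * q"
      "\<forall>x\<in>X. f x < k" and
      tw: "\<And>x x'. x\<in>X \<Longrightarrow> x'\<in>X \<Longrightarrow> f x = f x' \<Longrightarrow>
        lab x = lab x' \<and> (\<forall>y\<in>verts G - X. {x, y} \<in> edges G \<longleftrightarrow> {x', y} \<in> edges G)"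
      using disjoint_union.IH(1) by blast
    have new: "{x, y} \<in> edges G \<union> edges H \<longleftrightarrow> y \<in> verts G \<and> {x, y} \<in> edges G"
      if "x \<in> X" for x y
    proof -
      have "x \<in> verts G" using that X(1) by (rule rev_subsetD)
      then show ?thesis using disj[of x] disj[of y] edgeG[of x y] edgeH[of x y] by auto
    qed
    have old: "x \<in> verts G" if "x \<in> X" for x
      using that X(1) by blast
    have "\<forall>x\<in>X. \<forall>x'\<in>X. f x = f x' \<longrightarrow>
        (if x \<in> verts G then lab x else lab' x) = (if x' \<in> verts G then lab x' else lab' x') \<and>
        (\<forall>y\<in>verts G \<union> verts H - X.
          {x, y} \<in> edges G \<union> edges H \<longleftrightarrow> {x', y} \<in> edges G \<union> edges H)"
    proof (intro ballI impI conjI)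
      fix x x' assume x: "x \<in> X" "x' \<in> X" "f x = f x'"
      show "(if x \<in> verts G then lab x else lab' x) = (if x' \<in> verts G then lab x' else lab' x')"
        using tw[OF x] old x by simp
      show "{x, y} \<in> edges G \<union> edges H \<longleftrightarrow> {x', y} \<in> edges G \<union> edges H"
        if "y \<in> verts G \<union> verts H - X" for y
        unfolding new[OF x(1)] new[OF x(2)] using tw[OF x] that by blast
    qed
    moreover have "X \<subseteq> verts G \<union> verts H" using X(1) by blast
    ultimately show ?thesis unfolding ugraph.select_convs using X(2-4) by blast
  next
    case 2
    then obtain X f where X: "X \<subseteq> verts H" "q \<le> card (W \<inter> X)" "card (W \<inter> X) \<le> 2 * q"
      "\<forall>x\<in>X. f x < k" and
      tw: "\<And>x x'. x\<in>X \<Longrightarrow> x'\<in>X \<Longrightarrow> f x = f x' \<Longrightarrow>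
        lab' x = lab' x' \<and> (\<forall>y\<in>verts H - X. {x, y} \<in> edges H \<longleftrightarrow> {x', y} \<in> edges H)"
      using disjoint_union.IH(2) by blast
    have new: "{x, y} \<in> edges G \<union> edges H \<longleftrightarrow> y \<in> verts H \<and> {x, y} \<in> edges H"
      if "x \<in> X" for x y
    proof -
      have "x \<in> verts H" using that X(1) by (rule rev_subsetD)
      then show ?thesis using disj[of x] disj[of y] edgeG[of x y] edgeH[of x y] by auto
    qed
    have old: "x \<notin> verts G" if "x \<in> X" for x
      using that X(1) disj by blast
    have "\<forall>x\<in>X. \<forall>x'\<in>X. f x = f x' \<longrightarrow>
        (if x \<in> verts G then lab x else lab' x) = (if x' \<in> verts G then lab x' else lab' x') \<and>
        (\<forall>y\<in>verts G \<union> verts H - X.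
          {x, y} \<in> edges G \<union> edges H \<longleftrightarrow> {x', y} \<in> edges G \<union> edges H)"
    proof (intro ballI impI conjI)
      fix x x' assume x: "x \<in> X" "x' \<in> X" "f x = f x'"
      show "(if x \<in> verts G then lab x else lab' x) = (if x' \<in> verts G then lab x' else lab' x')"
        using tw[OF x] old x by simp
      show "{x, y} \<in> edges G \<union> edges H \<longleftrightarrow> {x', y} \<in> edges G \<union> edges H"
        if "y \<in> verts G \<union> verts H - X" for y
        unfolding new[OF x(1)] new[OF x(2)] using tw[OF x] that by blast
    qed
    moreover have "X \<subseteq> verts G \<union> verts H" using X(1) by blast
    ultimately show ?thesis unfolding ugraph.select_convs using X(2-4) by blast
  next
    case 3
    have "card (W \<inter> (verts G \<union> verts H)) \<le> card (W \<inter> verts G) + card (W \<inter> verts H)"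
      by (metis Int_Un_distrib card_Un_le)
    then show ?thesis
      using 3 disjoint_union.prems G H
      by (intro exI[of _ "verts G \<union> verts H"]
          exI[of _ "\<lambda>v. if v \<in> verts G then lab v else lab' v"]) auto
  qed
next
  case (join G lab i j)
  then have "q \<le> card (W \<inter> verts G)" by simp
  then obtain X f where X: "X \<subseteq> verts G" "q \<le> card (W \<inter> X)" "card (W \<inter> X) \<le> 2 * q"
      "\<forall>x\<in>X. f x < k" and
      tw: "\<And>x x'. x\<in>X \<Longrightarrow> x'\<in>X \<Longrightarrow> f x = f x' \<Longrightarrow>
        lab x = lab x' \<and> (\<forall>y\<in>verts G - X. {x, y} \<in> edges G \<longleftrightarrow> {x', y} \<in> edges G)"
    using join.IH by blast
  have "{x, y} \<in> {{u, v} |u v. u \<in> verts G \<and> v \<in> verts G \<and> lab u = i \<and> lab v = j} \<longleftrightarrow>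
      (lab x = i \<and> lab y = j \<or> lab x = j \<and> lab y = i)"
    if "x \<in> X" "y \<in> verts G" for x y
    using that X(1) by (auto simp: doubleton_eq_iff)
  note new = this
  have "\<forall>x\<in>X. \<forall>x'\<in>X. f x = f x' \<longrightarrow> lab x = lab x' \<and> (\<forall>y\<in>verts G - X.
      {x, y} \<in> edges G \<union>
        {{u, v} |u v. u \<in> verts G \<and> v \<in> verts G \<and> lab u = i \<and> lab v = j} \<longleftrightarrow>
      {x', y} \<in> edges G \<union>
        {{u, v} |u v. u \<in> verts G \<and> v \<in> verts G \<and> lab u = i \<and> lab v = j})"
  proof (intro ballI impI conjI)
    fix x x' assume x: "x \<in> X" "x' \<in> X" "f x = f x'"
    show "lab x = lab x'" using tw[OF x] by blast
    fix y assume "y \<in> verts G - X"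
    then show "{x, y} \<in> edges G \<union>
        {{u, v} |u v. u \<in> verts G \<and> v \<in> verts G \<and> lab u = i \<and> lab v = j} \<longleftrightarrow>
      {x', y} \<in> edges G \<union>
        {{u, v} |u v. u \<in> verts G \<and> v \<in> verts G \<and> lab u = i \<and> lab v = j}"
      using tw[OF x] new[OF x(1), of y] new[OF x(2), of y] unfolding Un_iff by simp
  qed
  then show ?case unfolding ugraph.select_convs using X by blast
next
  case (relabel G lab i j)
  then have "q \<le> card (W \<inter> verts G)" by simp
  then obtain X f where X: "X \<subseteq> verts G" "q \<le> card (W \<inter> X)" "card (W \<inter> X) \<le> 2 * q"
      "\<forall>x\<in>X. f x < k" and
      tw: "\<And>x x'. x\<in>X \<Longrightarrow> x'\<in>X \<Longrightarrow> f x = f x' \<Longrightarrow>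
        lab x = lab x' \<and> (\<forall>y\<in>verts G - X. {x, y} \<in> edges G \<longleftrightarrow> {x', y} \<in> edges G)"
    using relabel.IH by blast
  have "\<forall>x\<in>X. \<forall>x'\<in>X. f x = f x' \<longrightarrow>
      (if lab x = i then j else lab x) = (if lab x' = i then j else lab x') \<and>
      (\<forall>y\<in>verts G - X. {x, y} \<in> edges G \<longleftrightarrow> {x', y} \<in> edges G)"
    by (intro ballI impI conjI) (use tw in \<open>metis\<close>, use tw in \<open>blast\<close>)
  then show ?case using X by blast
qed

section \<open>Finite segments of a path-star graph\<close>

text \<open>The path-vertices are \<open>p\<^sub>1, \<dots>, p\<^sub>L\<^sub>-\<^sub>1\<close>, with \<open>L\<close> excluded, so that block boundaries can be
  used as values of \<open>L\<close>.\<close>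

definition path_star_segment :: "(nat \<Rightarrow> nat) \<Rightarrow> nat set \<Rightarrow> nat \<Rightarrow> ps_vertex ugraph" where
  "path_star_segment \<alpha> S L =
     induced_subgraph (path_star_graph \<alpha>) (PathV ` {1..<L} \<union> StarV ` S)"

lemma verts_segment:
  assumes "S \<subseteq> {1..}"
  shows "verts (path_star_segment \<alpha> S L) = PathV ` {1..<L} \<union> StarV ` S"
  using assms by (auto simp: path_star_segment_def induced_subgraph_def path_star_graph_def)

lemma path_edge_segment:
  "{PathV i, PathV j} \<in> edges (path_star_segment \<alpha> S L) \<longleftrightarrow>
     i \<in> {1..<L} \<and> j \<in> {1..<L} \<and> (j = Suc i \<or> i = Suc j)"
  by (auto simp: path_star_segment_def induced_subgraph_def path_star_graph_def doubleton_eq_iff)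

lemma star_edge_segment:
  "{PathV j, StarV a} \<in> edges (path_star_segment \<alpha> S L) \<longleftrightarrow> j \<in> {1..<L} \<and> a \<in> S \<and> \<alpha> j = a"
  by (auto simp: path_star_segment_def induced_subgraph_def path_star_graph_def doubleton_eq_iff)

lemma simple_path_star_graph:
  assumes "\<And>j. j \<ge> 1 \<Longrightarrow> \<alpha> j \<ge> 1"
  shows "simple_graph (path_star_graph \<alpha>)"
  unfolding simple_graph_def
proof
  fix e assume "e \<in> edges (path_star_graph \<alpha>)"
  then consider j where "j \<ge> 1" "e = {PathV j, PathV (j + 1)}"
    | j where "j \<ge> 1" "e = {PathV j, StarV (\<alpha> j)}"
    unfolding path_star_graph_def by auto
  then show "\<exists>u v. e = {u, v} \<and> u \<in> verts (path_star_graph \<alpha>) \<and>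
      v \<in> verts (path_star_graph \<alpha>) \<and> u \<noteq> v"
  proof cases
    case 1
    then show ?thesis
      by (intro exI[of _ "PathV j"] exI[of _ "PathV (j + 1)"]) (auto simp: path_star_graph_def)
  next
    case 2
    then show ?thesis using assms[of j]
      by (intro exI[of _ "PathV j"] exI[of _ "StarV (\<alpha> j)"]) (auto simp: path_star_graph_def)
  qed
qed

lemma segment_in_class:
  assumes "\<And>j. j \<ge> 1 \<Longrightarrow> \<alpha> j \<ge> 1" and "S \<subseteq> {1..}" and "finite S"
  shows "path_star_segment \<alpha> S L \<in> path_star_class \<alpha>"
proof -
  let ?U = "PathV ` {1..<L} \<union> StarV ` S"
  have "simple_graph (path_star_segment \<alpha> S L)"
    unfolding path_star_segment_def by (rule simple_induced[OF simple_path_star_graph[OF assms(1)]])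
  moreover have "?U \<subseteq> verts (path_star_graph \<alpha>)" using assms(2) by (auto simp: path_star_graph_def)
  moreover have "isomorphic (path_star_segment \<alpha> S L) (induced_subgraph (path_star_graph \<alpha>) ?U)"
    unfolding isomorphic_def path_star_segment_def by (rule exI[of _ id]) simp
  moreover have "finite ?U" using assms(3) by simp
  ultimately show ?thesis unfolding path_star_class_def by blast
qed

text \<open>Block \<open>l\<close> is \<open>{b l..<b (Suc l)}\<close>. The blocks start at \<open>1\<close> because the word does.\<close>

definition block_boundaries :: "(nat \<Rightarrow> nat) \<Rightarrow> nat set \<Rightarrow> (nat \<Rightarrow> nat) \<Rightarrow> bool" where
  "block_boundaries \<alpha> S b \<longleftrightarrow>
     b 0 = 1 \<and> strict_mono b \<and> (\<forall>l. \<forall>a\<in>S. \<exists>j\<in>{b l..<b (Suc l)}. \<alpha> j = a)"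

text \<open>From any position on, each of the finitely many letters occurs again, so a block can always be
  closed after the last of these next occurrences.\<close>

lemma block_boundaries_exist:
  assumes "finite S" and "\<And>a. a \<in> S \<Longrightarrow> infinite {j. j \<ge> 1 \<and> \<alpha> j = a}"
  shows "\<exists>b. block_boundaries \<alpha> S b"
proof -
  have "\<exists>y>x. \<forall>a\<in>S. \<exists>j\<in>{x..<y}. \<alpha> j = a" for x
  proof -
    have "\<exists>j\<ge>x. \<alpha> j = a" if "a \<in> S" for a
    proof (rule ccontr)
      assume "\<not> ?thesis"
      then have "{j. j \<ge> 1 \<and> \<alpha> j = a} \<subseteq> {..<x}" by (auto simp: not_le)
      then show False using assms(2)[OF that] finite_subset by blast
    qed
    then obtain f where f: "\<And>a. a \<in> S \<Longrightarrow> f a \<ge> x \<and> \<alpha> (f a) = a" by metis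
    define y where "y = Suc (Max (insert x (f ` S)))"
    have "z < y" if "z \<in> insert x (f ` S)" for z
      unfolding y_def using that assms(1) by (simp add: less_Suc_eq_le del: Max_insert)
    then show ?thesis using f by (intro exI[of _ y]) force
  qed
  then obtain nxt where nxt: "\<And>x. nxt x > x \<and> (\<forall>a\<in>S. \<exists>j\<in>{x..<nxt x}. \<alpha> j = a)" by metis
  have "block_boundaries \<alpha> S (\<lambda>l. (nxt ^^ l) 1)"
    unfolding block_boundaries_def strict_mono_Suc_iff using nxt by simp
  then show ?thesis by blast
qed

lemma letter_in_block:
  assumes "block_boundaries \<alpha> S b" and "a \<in> S"
  obtains j where "j \<in> {b l..<b (Suc l)}" "\<alpha> j = a"
  using assms unfolding block_boundaries_def by blast

lemma block_in_segment:
  assumes "block_boundaries \<alpha> S b" and "l < n"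
  shows "{b l..<b (Suc l)} \<subseteq> {1..<b n}"
proof -
  have "mono b" using assms(1) by (simp add: block_boundaries_def strict_mono_mono)
  then have "b 0 \<le> b l" "b (Suc l) \<le> b n" using assms(2) by (auto simp: mono_def)
  then show ?thesis using assms(1) by (auto simp: block_boundaries_def)
qed

lemma blocks_ordered:
  assumes "block_boundaries \<alpha> S b" and "l < l'"
    and "i \<in> {b l..<b (Suc l)}" "j \<in> {b l'..<b (Suc l')}"
  shows "i < j"
proof -
  have "mono b" using assms(1) by (simp add: block_boundaries_def strict_mono_mono)
  then have "b (Suc l) \<le> b l'" using assms(2) by (auto simp: mono_def)
  then show ?thesis using assms(3,4) by simp
qed

section \<open>Tree-width of segments\<close>

lemma sym_steps_within_rtrancl: "sym ((steps_within G S)\<^sup>*)"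
  by (rule sym_rtrancl) (auto simp: sym_def steps_within_def insert_commute)

lemma connected_block_with_star:
  assumes "S \<subseteq> {1..}" and b: "block_boundaries \<alpha> S b" and "l < n" and "a \<in> S"
  shows "connected_graph (induced_subgraph (path_star_segment \<alpha> S (b n))
           (insert (StarV a) (PathV ` {b l..<b (Suc l)})))"
proof -
  let ?G = "path_star_segment \<alpha> S (b n)" and ?M = "insert (StarV a) (PathV ` {b l..<b (Suc l)})"
  let ?R = "(steps_within ?G ?M)\<^sup>*"
  note block = block_in_segment[OF b \<open>l < n\<close>]
  have M: "?M \<subseteq> verts ?G" using block \<open>a \<in> S\<close> by (auto simp: verts_segment[OF assms(1)])
  have up: "(PathV (b l), PathV j) \<in> ?R" if "b l \<le> j" "j < b (Suc l)" for j
    using that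
  proof (induction rule: dec_induct)
    case (step i)
    have "i \<in> {1..<b n}" "Suc i \<in> {1..<b n}" using step block by (auto simp: subset_iff)
    then have "(PathV i, PathV (Suc i)) \<in> steps_within ?G ?M"
      using step by (auto simp: steps_within_def path_edge_segment)
    then show ?case using step by simp
  qed simp
  obtain j where j: "j \<in> {b l..<b (Suc l)}" "\<alpha> j = a"
    using letter_in_block[OF b \<open>a \<in> S\<close>] by blast
  then have "(PathV j, StarV a) \<in> steps_within ?G ?M"
    using block \<open>a \<in> S\<close> by (auto simp: steps_within_def star_edge_segment subset_iff)
  then have "(PathV (b l), StarV a) \<in> ?R" using up[of j] j(1) by simp
  then have from_start: "(PathV (b l), x) \<in> ?R" if "x \<in> ?M" for x
    using that up by auto
  have "(x, y) \<in> ?R" if "x \<in> ?M" "y \<in> ?M" for x y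
    using from_start[OF that(1)] from_start[OF that(2)] symD[OF sym_steps_within_rtrancl]
    by (meson rtrancl_trans)
  then show ?thesis unfolding connected_induced_iff[OF M] by blast
qed

text \<open>The branch sets of the complete minor pair each star with one block. Any two are joined
  by an edge because the letter of either star also occurs in the block of the other.\<close>

lemma segment_tree_width:
  assumes "\<And>j. j \<ge> 1 \<Longrightarrow> \<alpha> j \<ge> 1" and S: "S \<subseteq> {1..}" "finite S" and b: "block_boundaries \<alpha> S b"
  shows "card S \<le> tree_width (path_star_segment \<alpha> S (b (card S))) + 1"
proof -
  let ?n = "card S"
  let ?G = "path_star_segment \<alpha> S (b ?n)"
  obtain s where s: "bij_betw s {..<?n} S"
    using ex_bij_betw_nat_finite[OF S(2)] by (auto simp: lessThan_atLeast0)
  define M where "M l = insert (StarV (s l)) (PathV ` {b l..<b (Suc l)})" for l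
  have sS: "s l \<in> S" if "l < ?n" for l using s that by (auto simp: bij_betw_def)
  show ?thesis
  proof (rule complete_minor_le_tree_width)
    show "simple_graph ?G"
      unfolding path_star_segment_def
      by (rule simple_induced[OF simple_path_star_graph[OF assms(1)]])
    show "finite (verts ?G)" using S by (simp add: verts_segment)
    show "M l \<subseteq> verts ?G \<and> connected_graph (induced_subgraph ?G (M l))" if "l < ?n" for l
      unfolding M_def
      using connected_block_with_star[OF S(1) b that sS[OF that]] block_in_segment[OF b that] sS[OF that]
      by (auto simp: verts_segment[OF S(1)])
    show "M l \<inter> M l' = {}" if l: "l < ?n" "l' < ?n" "l \<noteq> l'" for l l'
    proof -
      have "s l \<noteq> s l'" using s l by (auto simp: bij_betw_def inj_on_def)
      moreover have "{b l..<b (Suc l)} \<inter> {b l'..<b (Suc l')} = {}"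
        using blocks_ordered[OF b, of l l'] blocks_ordered[OF b, of l' l] l(3)
        by (metis disjoint_iff less_irrefl linorder_neqE_nat)
      ultimately show ?thesis unfolding M_def by auto
    qed
    show "\<exists>x\<in>M l. \<exists>y\<in>M l'. {x, y} \<in> edges ?G" if l: "l < ?n" "l' < ?n" "l \<noteq> l'" for l l'
    proof -
      obtain j where j: "j \<in> {b l..<b (Suc l)}" "\<alpha> j = s l'"
        using letter_in_block[OF b sS[OF l(2)]] by blast
      then have "{PathV j, StarV (s l')} \<in> edges ?G"
        using block_in_segment[OF b l(1)] sS[OF l(2)] by (auto simp: star_edge_segment subset_iff)
      then show ?thesis using j(1) unfolding M_def by blast
    qed
  qed
qed

section \<open>Clique-width of segments\<close>

lemma consecutive_change:
  fixes P :: "nat \<Rightarrow> bool"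
  assumes "i \<in> {m..<n}" "P i" "j \<in> {m..<n}" "\<not> P j"
  shows "\<exists>u\<in>{m..<n}. \<exists>v\<in>{m..<n}. P u \<and> \<not> P v \<and> (v = Suc u \<or> u = Suc v)"
proof (rule ccontr)
  assume "\<not> ?thesis"
  then have no: "P v" if "u \<in> {m..<n}" "v \<in> {m..<n}" "P u" "v = Suc u \<or> u = Suc v" for u v
    using that by blast
  have "P k \<longleftrightarrow> P m" if "m \<le> k" "k < n" for k
    using that
  proof (induction rule: dec_induct)
    case (step k)
    then have "k \<in> {m..<n}" "Suc k \<in> {m..<n}" "P k \<longleftrightarrow> P m" by simp_all
    then show ?case using no[of k "Suc k"] no[of "Suc k" k] by blast
  qed simp
  from this[of i] this[of j] show False using assms by simp
qed

text \<open>With \<open>3 * (c + 1)\<close> stars, the balanced cut for \<open>q = c + 1\<close> leaves between \<open>c + 1\<close> and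
  \<open>2 * (c + 1)\<close> stars on either side, more than the number of classes if \<open>k \<le> c\<close>. One block per
  class plus one more, \<open>c + 1\<close> in total, suffices for the last counting step.\<close>

lemma segment_clique_width_gt:
  assumes S: "S \<subseteq> {1..}" "finite S" "card S = 3 * (c + 1)" and b: "block_boundaries \<alpha> S b"
    and cw: "cw_construct k (path_star_segment \<alpha> S (b (c + 1))) lab"
  shows "c < k"
proof (rule ccontr)
  assume "\<not> c < k"
  let ?G = "path_star_segment \<alpha> S (b (c + 1))"
  have verts: "verts ?G = PathV ` {1..<b (c + 1)} \<union> StarV ` S" by (rule verts_segment[OF S(1)])
  have "StarV ` S \<inter> verts ?G = StarV ` S" unfolding verts by blast
  moreover have "card (StarV ` S) = 3 * (c + 1)" using S(3) by (simp add: card_image inj_on_def)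
  ultimately have "c + 1 \<le> card (StarV ` S \<inter> verts ?G)" by simp
  from balanced_cut_with_few_types[OF cw le_add2 this]
  obtain X f where X: "X \<subseteq> verts ?G" "c + 1 \<le> card (StarV ` S \<inter> X)"
      "card (StarV ` S \<inter> X) \<le> 2 * (c + 1)" and fk: "\<forall>x\<in>X. f x < k" and
    classes: "\<forall>x\<in>X. \<forall>x'\<in>X. f x = f x' \<longrightarrow> lab x = lab x' \<and>
      (\<forall>y\<in>verts ?G - X. {x, y} \<in> edges ?G \<longleftrightarrow> {x', y} \<in> edges ?G)"
    by (elim exE conjE)
  have types: "\<And>x x' y. x \<in> X \<Longrightarrow> x' \<in> X \<Longrightarrow> f x = f x' \<Longrightarrow> y \<in> verts ?G - X \<Longrightarrow>
      {x, y} \<in> edges ?G \<longleftrightarrow> {x', y} \<in> edges ?G"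
    using classes by blast
  \<comment> \<open>A set on which \<open>f \<circ> g\<close> is injective has at most \<open>k \<le> c\<close> elements.\<close>
  have bound: "card A \<le> c" if "\<And>a. a \<in> A \<Longrightarrow> g a \<in> X" "inj_on (\<lambda>a. f (g a)) A"
    for g and A :: "nat set"
  proof -
    have "(\<lambda>a. f (g a)) ` A \<subseteq> {..<k}" using that(1) fk by auto
    then have "card A \<le> card {..<k}" using that(2) by (meson card_inj_on_le finite_lessThan)
    then show ?thesis using \<open>\<not> c < k\<close> by simp
  qed
  define inside where "inside = {a \<in> S. StarV a \<in> X}"
  define outside where "outside = S - inside"
  have "StarV ` S \<inter> X = StarV ` inside" by (auto simp: inside_def)
  then have "card (StarV ` S \<inter> X) = card inside" by (simp add: card_image inj_on_def)
  moreover have "card outside = card S - card inside"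
    unfolding outside_def by (rule card_Diff_subset) (use S(2) in \<open>auto simp: inside_def\<close>)
  ultimately have large: "c < card inside" "c < card outside"
    using X(2,3) S(3) by simp_all
  have cross: "\<exists>u\<in>{b l..<b (Suc l)}. \<exists>v\<in>{b l..<b (Suc l)}.
      PathV u \<in> X \<and> PathV v \<notin> X \<and> (v = Suc u \<or> u = Suc v)" if l: "l < c + 1" for l
  proof -
    note block = block_in_segment[OF b l]
    have "\<forall>a\<in>S. \<exists>j. j \<in> {b l..<b (Suc l)} \<and> \<alpha> j = a" using letter_in_block[OF b] by metis
    then obtain p where "\<forall>a\<in>S. p a \<in> {b l..<b (Suc l)} \<and> \<alpha> (p a) = a" by (rule bchoice[THEN exE])
    then have p: "\<And>a. a \<in> S \<Longrightarrow> p a \<in> {b l..<b (Suc l)}" "\<And>a. a \<in> S \<Longrightarrow> \<alpha> (p a) = a" by auto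
    have pseg: "p a \<in> {1..<b (c + 1)}" if "a \<in> S" for a using p(1)[OF that] block by blast
    \<comment> \<open>A block outside \<open>X\<close> contains, for each star in \<open>X\<close>, a vertex adjacent to that star and to no other.\<close>
    have "\<exists>i\<in>{b l..<b (Suc l)}. PathV i \<in> X"
    proof (rule ccontr)
      assume none: "\<not> ?thesis"
      have "inj_on (\<lambda>a. f (StarV a)) inside"
      proof (rule inj_onI)
        fix a a' assume a: "a \<in> inside" "a' \<in> inside" "f (StarV a) = f (StarV a')"
        then have aS: "a \<in> S" "a' \<in> S" "StarV a \<in> X" "StarV a' \<in> X" by (auto simp: inside_def)
        have "PathV (p a) \<in> verts ?G - X" using none p(1) pseg aS(1) unfolding verts by blast
        then have "{PathV (p a), StarV a} \<in> edges ?G \<longleftrightarrow> {PathV (p a), StarV a'} \<in> edges ?G"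
          using types[OF aS(3,4) a(3)]
          by (simp only: insert_commute[of "PathV (p a)"])
        then show "a = a'" using aS p(2) pseg by (simp add: star_edge_segment)
      qed
      then show False using bound[of inside StarV] large by (auto simp: inside_def)
    qed
    \<comment> \<open>In a block inside \<open>X\<close>, the vertices \<open>p a\<close> for the stars \<open>a\<close> outside are told apart by these stars.\<close>
    moreover have "\<exists>j\<in>{b l..<b (Suc l)}. PathV j \<notin> X"
    proof (rule ccontr)
      assume all: "\<not> ?thesis"
      then have pX: "PathV (p a) \<in> X" if "a \<in> S" for a using p(1)[OF that] by blast
      have "inj_on (\<lambda>a. f (PathV (p a))) outside"
      proof (rule inj_onI)
        fix a a' assume a: "a \<in> outside" "a' \<in> outside" "f (PathV (p a)) = f (PathV (p a'))"
        then have aS: "a \<in> S" "a' \<in> S" "StarV a \<notin> X" by (auto simp: outside_def inside_def)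
        have "StarV a \<in> verts ?G - X" using aS unfolding verts by blast
        then have "{PathV (p a), StarV a} \<in> edges ?G \<longleftrightarrow> {PathV (p a'), StarV a} \<in> edges ?G"
          using types[OF pX[OF aS(1)] pX[OF aS(2)] a(3)] by simp
        then show "a = a'" using aS p(2) pseg by (simp add: star_edge_segment)
      qed
      then show False using bound[of outside "\<lambda>a. PathV (p a)"] large pX by (auto simp: outside_def)
    qed
    ultimately show ?thesis
      using consecutive_change[of _ "b l" "b (Suc l)" "\<lambda>i. PathV i \<in> X"] by blast
  qed
  then have "\<forall>l. \<exists>u v. l < c + 1 \<longrightarrow> u \<in> {b l..<b (Suc l)} \<and> v \<in> {b l..<b (Suc l)} \<and>
      PathV u \<in> X \<and> PathV v \<notin> X \<and> (v = Suc u \<or> u = Suc v)"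
    by blast
  then obtain u v where "\<forall>l. l < c + 1 \<longrightarrow> u l \<in> {b l..<b (Suc l)} \<and> v l \<in> {b l..<b (Suc l)} \<and>
      PathV (u l) \<in> X \<and> PathV (v l) \<notin> X \<and> (v l = Suc (u l) \<or> u l = Suc (v l))"
    unfolding choice_iff by (elim exE)
  then have uv: "u l \<in> {b l..<b (Suc l)}" "v l \<in> {b l..<b (Suc l)}" "PathV (u l) \<in> X"
    "PathV (v l) \<notin> X" "v l = Suc (u l) \<or> u l = Suc (v l)" if "l < c + 1" for l
    using that by blast+
  have seg: "u l \<in> {1..<b (c + 1)}" "v l \<in> {1..<b (c + 1)}" if "l < c + 1" for l
    using uv(1,2)[OF that] block_in_segment[OF b that] by blast+
  have "inj_on (\<lambda>l. f (PathV (u l))) {..<c + 1}"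
  proof (rule linorder_inj_onI')
    fix l l' assume l: "l \<in> {..<c + 1}" "l' \<in> {..<c + 1}" "l < l'"
    then have L: "l < c + 1" "l' < c + 1" by auto
    show "f (PathV (u l)) \<noteq> f (PathV (u l'))"
    proof
      assume eq: "f (PathV (u l)) = f (PathV (u l'))"
      \<comment> \<open>Equal classes make \<open>u l'\<close> adjacent to \<open>v l\<close>, and \<open>u l\<close> to \<open>v l'\<close>. But only the last vertex
        of a block can have a neighbour in a later block, and \<open>u l\<close>, \<open>v l\<close> are not both last.\<close>
      have out: "PathV (v l) \<in> verts ?G - X" "PathV (v l') \<in> verts ?G - X"
        using seg L uv(4) unfolding verts by blast+
      have "{PathV (u l), PathV (v l)} \<in> edges ?G" "{PathV (u l'), PathV (v l')} \<in> edges ?G"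
        unfolding path_edge_segment using uv(5) seg L by blast+
      then have "{PathV (u l'), PathV (v l)} \<in> edges ?G" "{PathV (u l), PathV (v l')} \<in> edges ?G"
        using types[OF uv(3)[OF L(1)] uv(3)[OF L(2)] eq] out by blast+
      then have "u l' = Suc (v l) \<or> v l = Suc (u l')" "u l = Suc (v l') \<or> v l' = Suc (u l)"
        unfolding path_edge_segment by blast+
      moreover have "u l < u l'" "u l < v l'" "v l < u l'" "v l < v l'"
        using blocks_ordered[OF b l(3)] uv(1,2) L by blast+
      ultimately show False using uv(5)[OF L(1)] by linarith
    qed
  qed
  then have "card {..<c + 1} \<le> c" using uv(3) by (intro bound) auto
  then show False by simp
qed

theorem theorem4p2:
  fixes \<alpha> :: "nat \<Rightarrow> nat" and A :: "nat set"
  assumes "infinite_word A \<alpha>"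
    and "infinite (recurring_letters A \<alpha>)"
  shows "unbounded_tree_width (path_star_class \<alpha>) \<and> unbounded_clique_width (path_star_class \<alpha>)"
proof -
  have pos: "\<alpha> j \<ge> 1" if "j \<ge> 1" for j
    using assms(1) that by (auto simp: infinite_word_def)
  have ex: "\<exists>S b. S \<subseteq> {1..} \<and> finite S \<and> card S = n \<and> block_boundaries \<alpha> S b" for n
  proof -
    obtain S where S: "finite S" "card S = n" "S \<subseteq> recurring_letters A \<alpha>"
      using infinite_arbitrarily_large[OF assms(2)] by blast
    then have "S \<subseteq> {1..}" and inf: "\<And>a. a \<in> S \<Longrightarrow> infinite {j. j \<ge> 1 \<and> \<alpha> j = a}"
      using assms(1) by (auto simp: recurring_letters_def infinite_word_def)
    obtain b where "block_boundaries \<alpha> S b" using block_boundaries_exist[OF S(1) inf] by blast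
    then show ?thesis using S(1,2) \<open>S \<subseteq> {1..}\<close> by blast
  qed
  have "\<exists>G\<in>path_star_class \<alpha>. c < tree_width G" for c
  proof -
    obtain S b where S: "S \<subseteq> {1..}" "finite S" "card S = c + 2" "block_boundaries \<alpha> S b"
      using ex by blast
    then show ?thesis
      using segment_tree_width[OF pos S(1,2,4)] segment_in_class[OF pos S(1,2)]
      by (intro bexI[of _ "path_star_segment \<alpha> S (b (card S))"]) auto
  qed
  moreover have "\<exists>G\<in>path_star_class \<alpha>. c < clique_width G" for c
  proof -
    obtain S b where S: "S \<subseteq> {1..}" "finite S" "card S = 3 * (c + 1)" "block_boundaries \<alpha> S b"
      using ex by blast
    let ?G = "path_star_segment \<alpha> S (b (c + 1))"
    have "?G \<in> path_star_class \<alpha>" by (rule segment_in_class[OF pos S(1,2)])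
    moreover from this have "simple_graph ?G" by (simp add: path_star_class_def)
    moreover have "finite (verts ?G)" "verts ?G \<noteq> {}"
      using S(1-3) by (auto simp: verts_segment)
    ultimately show ?thesis
      using cw_construct_le_clique_width segment_clique_width_gt[OF S] by blast
  qed
  ultimately show ?thesis
    unfolding unbounded_tree_width_def unbounded_clique_width_def by (metis not_le)
qed

end
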